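(* Let $D$ be an integral domain. Then $D$ is a strong Furstenberg domain if and only if $D$ is both a Furstenberg domain and an AP-domain.
   Context: Let $D$ be an integral domain. An atom (irreducible element) of $D$ is a nonunit $a\in D$ such that $a=bc$ with $b,c\in D$ implies that $b$ or $c$ is a unit. A prime element of $D$ is a nonzero nonunit $p\in D$ such that $p\mid ab$ implies $p\mid a$ or $p\mid b$ for all $a,b\in D$. $D$ is a Furstenberg domain if every nonzero nonunit element of $D$ has at least one irreducible divisor in $D$. $D$ is a strong Furstenberg domain if every nonzero nonunit element of $D$ has at least one prime divisor in $D$. $D$ is an AP-domain if every irreducible element of $D$ is prime. *)

theory Defs
  imports "HOL-Computational_Algebra.Factorial_Ring"
begin

text \<open>
  An integral domain is a type \<open>'a\<close> of class \<^class>\<open>idom\<close>, passed to the predicates below as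
  \<open>TYPE('a)\<close>.  Atoms and prime elements are the library's \<^const>\<open>irreducible\<close> and
  \<^const>\<open>prime_elem\<close>; the condition \<open>p \<noteq> 0\<close> that the library puts into \<^const>\<open>irreducible\<close>
  is harmless, since \<open>0 = 0 * 0\<close> and \<open>0\<close> is not a unit of a domain.
\<close>

definition furstenberg_domain :: "'a::idom itself \<Rightarrow> bool" where
  "furstenberg_domain TYPE('a) \<longleftrightarrow>
     (\<forall>a::'a. a \<noteq> 0 \<and> \<not> a dvd 1 \<longrightarrow> (\<exists>p. irreducible p \<and> p dvd a))"

definition strong_furstenberg_domain :: "'a::idom itself \<Rightarrow> bool" where
  "strong_furstenberg_domain TYPE('a) \<longleftrightarrow>
     (\<forall>a::'a. a \<noteq> 0 \<and> \<not> a dvd 1 \<longrightarrow> (\<exists>p. prime_elem p \<and> p dvd a))"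

definition AP_domain :: "'a::idom itself \<Rightarrow> bool" where
  "AP_domain TYPE('a) \<longleftrightarrow> (\<forall>p::'a. irreducible p \<longrightarrow> prime_elem p)"

end

theory Submission
  imports Defs
begin

text \<open>
  Primes of a domain are atoms (by cancellation), so prime divisors are in particular irreducible
  divisors; the Furstenberg property is therefore the weaker one, and it becomes the strong one as
  soon as atoms are prime.  The remaining point is that a prime divisor of an atom absorbs the
  whole atom: the cofactor has to be a unit, so the two are associated, and primality passes to
  associates.
\<close>

text \<open>
  If \<open>p = a * b\<close> and \<open>p\<close> divides the factor \<open>a\<close>, then \<open>a = a * (b * c)\<close> for some \<open>c\<close>, and cancelling
  \<open>a\<close> makes \<open>b\<close> a unit.  The argument stays with cancellation because the library fact
  \<open>prime_elem_imp_irreducible\<close> is about \<^class>\<open>algebraic_semidom\<close>, where a division operation is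
  part of the structure, as it is not in \<^class>\<open>idom\<close>.
\<close>

lemma idom_prime_elem_imp_irreducible:
  fixes p :: "'a::idom"
  assumes p: "prime_elem p"
  shows "irreducible p"
proof (rule irreducibleI)
  show "p \<noteq> 0" "\<not> p dvd 1"
    using p by (simp_all add: prime_elem_def)
next
  have cofactor_unit: "b dvd 1" if "p = a * b" "p dvd a" for a b
  proof -
    from \<open>p dvd a\<close> obtain c where "a = p * c" ..
    also have "p * c = a * (b * c)"
      unfolding \<open>p = a * b\<close> by (rule mult.assoc)
    finally have "a * 1 = a * (b * c)"
      by (simp only: mult_1_right)
    moreover have "a \<noteq> 0"
      using p \<open>p = a * b\<close> by (auto simp: prime_elem_def)
    ultimately have "1 = b * c"
      using mult_left_cancel by blast
    then show ?thesis ..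
  qed
  fix a b
  assume ab: "p = a * b"
  then have ba: "p = b * a"
    by (simp only: mult.commute)
  have "p dvd a * b"
    using ab by simp
  with p have "p dvd a \<or> p dvd b"
    by (rule prime_elem_dvd_multD)
  then show "a dvd 1 \<or> b dvd 1"
    using cofactor_unit[OF ab] cofactor_unit[OF ba] by blast
qed

text \<open>
  Writing \<open>q = p * u\<close>, irreducibility of \<open>q\<close> makes \<open>p\<close> or \<open>u\<close> a unit, and a prime is not a unit.
  So \<open>u\<close> is a unit and \<open>p\<close> and \<open>q\<close> have the same multiples.  Apart from being a nonzero
  nonunit, which \<open>q\<close> is as an atom, primality is a condition on the set of multiples alone.
\<close>

lemma irreducible_with_prime_divisor_is_prime:
  fixes p q :: "'a::idom"
  assumes q: "irreducible q" and p: "prime_elem p" and "p dvd q"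
  shows "prime_elem q"
proof -
  from \<open>p dvd q\<close> obtain u where u: "q = p * u" ..
  have "\<not> p dvd 1"
    using p by (simp add: prime_elem_def)
  with q u have "u dvd 1"
    using irreducibleD by blast
  then obtain v where v: "1 = u * v" ..
  have "p = q * v"
    by (simp add: u mult.assoc flip: v)
  then have "q dvd p" ..
  with \<open>p dvd q\<close> have assoc: "q dvd x \<longleftrightarrow> p dvd x" for x
    using dvd_trans by blast
  show ?thesis
    using q p by (auto simp: prime_elem_def irreducible_def assoc)
qed

theorem proposition3p1:
  "strong_furstenberg_domain TYPE('a::idom) \<longleftrightarrow>
     furstenberg_domain TYPE('a) \<and> AP_domain TYPE('a)"
proof (intro iffI conjI)
  assume strong: "strong_furstenberg_domain TYPE('a)"
  then show "furstenberg_domain TYPE('a)"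
    unfolding strong_furstenberg_domain_def furstenberg_domain_def
    using idom_prime_elem_imp_irreducible by blast
  show "AP_domain TYPE('a)"
    unfolding AP_domain_def
  proof (intro allI impI)
    fix q :: 'a
    assume q: "irreducible q"
    then have "q \<noteq> 0" "\<not> q dvd 1"
      by (simp_all add: irreducible_def)
    with strong obtain p where "prime_elem p" "p dvd q"
      unfolding strong_furstenberg_domain_def by blast
    with q show "prime_elem q"
      by (rule irreducible_with_prime_divisor_is_prime)
  qed
next
  assume "furstenberg_domain TYPE('a) \<and> AP_domain TYPE('a)"
  then show "strong_furstenberg_domain TYPE('a)"
    unfolding strong_furstenberg_domain_def furstenberg_domain_def AP_domain_def by blast
qed

end
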